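(* Let $R$ be a commutative ring with $1$ such that $\frac12\in R$, let $\mathcal{X}_R=\mathrm{Hom}(R,\mathbb{R})$ be nonempty, and assume the map $R\to C(\mathcal{X}_R)$, $a\mapsto\hat a$, is injective. Let $K$ be a compact subset of $\mathcal{X}_R$ and $d\ge1$ an integer. Assume that $L:R\to\mathbb{R}$ is a $\|\cdot\|_K$-continuous, $\mathbb{Z}[\frac12]$-linear map such that $L(a^{2d})\ge 0$ for all $a\in R$. Then there exists a Borel measure $\mu$ on $K$ such that $$L(a)=\int_K\hat a\,d\mu\qquad\text{for all }a\in R.$$
   Context: $\mathcal{X}_R=\mathrm{Hom}(R,\mathbb{R})$ is the set of unitary ring homomorphisms $\alpha:R\to\mathbb{R}$, with the subspace topology inherited from the product topology on $\mathbb{R}^R$. For $a\in R$, $\hat a:\mathcal{X}_R\to\mathbb{R}$ is $\hat a(\alpha)=\alpha(a)$. For $K$ compact, $\|a\|_K:=\sup_{\alpha\in K}|\alpha(a)|$ for $a\in R$, and the $\|\cdot\|_K$-topology on $R$ is the one whose neighborhoods of $a$ are generated by the balls $\{b\in R:\|a-b\|_K<\epsilon\}$, $\epsilon>0$ (not necessarily Hausdorff). Borel measures are positive. *)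

theory Defs
  imports "HOL-Analysis.Analysis"
begin

text \<open>The ring \<open>R\<close> is a type of class \<^class>\<open>comm_ring_1\<close>. This class demands \<open>0 \<noteq> 1\<close>,
  which is no restriction as soon as a unitary homomorphism from \<open>R\<close> to the reals exists.

  The type \<open>'a \<Rightarrow> real\<close> carries the product topology as its instance of
  \<^class>\<open>topological_space\<close>; hence, for \<open>K \<subseteq> real_homs\<close>, \<^term>\<open>compact K\<close> is compactness
  with respect to the subspace topology of \<^term>\<open>real_homs\<close>, and \<^term>\<open>restrict_space borel K\<close>
  carries the Borel sets of \<open>K\<close>.\<close>

definition real_homs :: "('a::comm_ring_1 \<Rightarrow> real) set" where
  "real_homs = {\<alpha>. \<alpha> 1 = 1 \<and> (\<forall>a b. \<alpha> (a + b) = \<alpha> a + \<alpha> b) \<and> (\<forall>a b. \<alpha> (a * b) = \<alpha> a * \<alpha> b)}"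

definition hat :: "'a::comm_ring_1 \<Rightarrow> ('a \<Rightarrow> real) \<Rightarrow> real" where
  "hat a = restrict (\<lambda>\<alpha>. \<alpha> a) real_homs"

text \<open>The supremum is taken in the nonnegative reals: inserting \<open>0\<close> only matters for empty \<open>K\<close>,
  where the seminorm is \<open>0\<close>.\<close>

definition seminorm_on :: "('a \<Rightarrow> real) set \<Rightarrow> 'a::comm_ring_1 \<Rightarrow> real" where
  "seminorm_on K a = Sup (insert 0 ((\<lambda>\<alpha>. \<bar>hat a \<alpha>\<bar>) ` K))"

definition seminorm_topology :: "('a \<Rightarrow> real) set \<Rightarrow> 'a::comm_ring_1 topology" where
  "seminorm_topology K =
     topology (\<lambda>U. \<forall>a\<in>U. \<exists>\<epsilon>>0. {b. seminorm_on K (a - b) < \<epsilon>} \<subseteq> U)"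

lemma openin_seminorm_topology:
  "openin (seminorm_topology K) U \<longleftrightarrow>
     (\<forall>a\<in>U. \<exists>\<epsilon>>0. {b. seminorm_on K (a - b) < \<epsilon>} \<subseteq> U)"
proof -
  let ?P = "\<lambda>U. \<forall>a\<in>U. \<exists>\<epsilon>>0. {b. seminorm_on K (a - b) < \<epsilon>} \<subseteq> U"
  have "istopology ?P"
    unfolding istopology_def
  proof (intro conjI allI impI)
    fix S T assume S: "?P S" and T: "?P T"
    show "?P (S \<inter> T)"
    proof
      fix a assume "a \<in> S \<inter> T"
      then obtain d e where "d > 0" "e > 0"
        and "{b. seminorm_on K (a - b) < d} \<subseteq> S" "{b. seminorm_on K (a - b) < e} \<subseteq> T"
        using S T by blast
      then show "\<exists>\<epsilon>>0. {b. seminorm_on K (a - b) < \<epsilon>} \<subseteq> S \<inter> T"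
        by (intro exI[of _ "min d e"]) auto
    qed
  next
    fix \<K> :: "'a set set" assume "\<forall>S\<in>\<K>. ?P S"
    then show "?P (\<Union>\<K>)"
      by (meson UnionE Union_upper subset_trans)
  qed
  then show ?thesis
    unfolding seminorm_topology_def by (simp add: topology_inverse')
qed

text \<open>Linearity over \<open>\<int>[1/2]\<close>, where \<open>h\<close> is the (unique) inverse of \<open>2\<close> in \<open>R\<close>: the scalar
  \<open>m / 2^k\<close> acts on \<open>R\<close> as multiplication by \<open>m h^k\<close>.\<close>

definition dyadic_linear :: "'a::comm_ring_1 \<Rightarrow> ('a \<Rightarrow> real) \<Rightarrow> bool" where
  "dyadic_linear h L \<longleftrightarrow>
     (\<forall>a b. L (a + b) = L a + L b) \<and>
     (\<forall>(m::int) (k::nat) a. L (of_int m * h ^ k * a) = (of_int m / 2 ^ k) * L a)"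

end

theory Submission
  imports Defs
begin

text \<open>The ring elements, viewed as functions on \<open>K\<close>, are uniformly dense in \<open>C(K)\<close> by Stone--Weierstrass,
  since the dyadic numbers are dense in the reals. If \<open>a\<close> is nonnegative on \<open>K\<close>, then approximating the
  continuous \<open>2d\<close>-th root of \<open>a\<close> by ring elements exhibits \<open>a\<close> as a limit of \<open>2d\<close>-th powers, so that
  \<open>L a \<ge> 0\<close> by continuity. Hence \<open>L\<close> extends to a positive additive functional on \<open>C(K)\<close>, which is
  integration against a Borel measure by the Riesz representation theorem. As \<open>K\<close> need not be metrizable,
  that measure is obtained by the Caratheodory construction from the outer measure whose value on open
  sets \<open>U\<close> is the supremum of the functional over continuous functions below the indicator of \<open>U\<close>.\<close>

section \<open>Separation axioms for product spaces\<close>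

lemma open_coordinate_vimage:
  "open U \<Longrightarrow> open ((\<lambda>x::'a \<Rightarrow> 'b::topological_space. x i) -` U)"
  by (intro open_vimage continuous_on_product_coordinates)

instance "fun" :: (type, t0_space) t0_space
proof
  fix f g :: "'a \<Rightarrow> 'b"
  assume "f \<noteq> g"
  then obtain i where "f i \<noteq> g i"
    by blast
  then obtain U where "open U" "\<not> (f i \<in> U \<longleftrightarrow> g i \<in> U)"
    using t0_space_class.t0_space by metis
  then show "\<exists>U. open U \<and> \<not> (f \<in> U \<longleftrightarrow> g \<in> U)"
    by (intro exI[of _ "(\<lambda>x. x i) -` U"]) (auto intro: open_coordinate_vimage)
qed

instance "fun" :: (type, t1_space) t1_space
proof
  fix f g :: "'a \<Rightarrow> 'b"
  assume "f \<noteq> g"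
  then obtain i where "f i \<noteq> g i"
    by blast
  then obtain U where "open U" "f i \<in> U" "g i \<notin> U"
    using t1_space_class.t1_space by metis
  then show "\<exists>U. open U \<and> f \<in> U \<and> g \<notin> U"
    by (intro exI[of _ "(\<lambda>x. x i) -` U"]) (auto intro: open_coordinate_vimage)
qed

text \<open>Distinct functions differ at some coordinate, and preimages of open sets under that
  coordinate separate them. This makes the function space containing \<open>K\<close> an instance of
  the Hausdorff type in the locale below.\<close>

instance "fun" :: (type, t2_space) t2_space
proof
  fix f g :: "'a \<Rightarrow> 'b"
  assume "f \<noteq> g"
  then obtain i where "f i \<noteq> g i"
    by blast
  then obtain U V where "open U" "open V" "f i \<in> U" "g i \<in> V" "U \<inter> V = {}"
    using hausdorff by metis
  then show "\<exists>U V. open U \<and> open V \<and> f \<in> U \<and> g \<in> V \<and> U \<inter> V = {}"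
    by (intro exI[of _ "(\<lambda>x. x i) -` U"] exI[of _ "(\<lambda>x. x i) -` V"])
       (auto intro: open_coordinate_vimage)
qed

section \<open>The Riesz representation theorem on compact Hausdorff spaces\<close>

text \<open>Additivity and positivity are what the extension of \<open>L\<close> offers directly.
  Homogeneity enters below only for natural multiples, which are repeated sums.\<close>

locale positive_functional =
  fixes K :: "'b::t2_space set" and \<Lambda> :: "('b \<Rightarrow> real) \<Rightarrow> real"
  assumes compact_K: "compact K"
    and add: "continuous_on K f \<Longrightarrow> continuous_on K g \<Longrightarrow> \<Lambda> (\<lambda>x. f x + g x) = \<Lambda> f + \<Lambda> g"
    and pos: "continuous_on K f \<Longrightarrow> (\<And>x. x \<in> K \<Longrightarrow> 0 \<le> f x) \<Longrightarrow> 0 \<le> \<Lambda> f"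
begin

section \<open>Elementary properties of positive additive functionals\<close>

text \<open>Write \<open>g\<close> as \<open>f + (g - f)\<close>. Applied in both directions, this
  also shows that \<open>\<Lambda> f\<close> depends only on the values of \<open>f\<close> on
  \<open>K\<close>.\<close>

lemma mono:
  assumes "continuous_on K f" "continuous_on K g" "\<And>x. x \<in> K \<Longrightarrow> f x \<le> g x"
  shows "\<Lambda> f \<le> \<Lambda> g"
proof -
  have "\<Lambda> (\<lambda>x. f x + (g x - f x)) = \<Lambda> f + \<Lambda> (\<lambda>x. g x - f x)"
    by (intro add continuous_intros assms)
  moreover have "0 \<le> \<Lambda> (\<lambda>x. g x - f x)"
    by (intro pos continuous_intros assms) (use assms(3) in auto)
  ultimately show ?thesis
    by simp
qed

lemma zero: "\<Lambda> (\<lambda>x. 0) = 0"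
  using add[of "\<lambda>x. 0" "\<lambda>x. 0"] by simp

lemma sum:
  fixes n :: nat
  assumes "\<And>i. i < n \<Longrightarrow> continuous_on K (f i)"
  shows "\<Lambda> (\<lambda>x. \<Sum>i<n. f i x) = (\<Sum>i<n. \<Lambda> (f i))"
  using assms
proof (induction n)
  case (Suc n)
  have "\<Lambda> (\<lambda>x. (\<Sum>i<n. f i x) + f n x) = \<Lambda> (\<lambda>x. \<Sum>i<n. f i x) + \<Lambda> (f n)"
    using Suc.prems by (intro add continuous_on_sum) auto
  then show ?case
    using Suc by simp
qed (simp add: zero)

lemma scale_nat:
  assumes "continuous_on K f"
  shows "\<Lambda> (\<lambda>x. real n * f x) = real n * \<Lambda> f"
  using sum[of n "\<lambda>_. f"] assms by simp

lemma diff: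
  assumes "continuous_on K f" "continuous_on K g"
  shows "\<Lambda> (\<lambda>x. f x - g x) = \<Lambda> f - \<Lambda> g"
proof -
  have "\<Lambda> (\<lambda>x. (f x - g x) + g x) = \<Lambda> (\<lambda>x. f x - g x) + \<Lambda> g"
    by (intro add continuous_intros assms)
  then show ?thesis
    by simp
qed

text \<open>Additivity gives \<open>n * \<Lambda> (1/n) = \<Lambda> 1\<close>, so a large
  \<open>n\<close> makes the value at the constant \<open>1/n\<close> as small as desired.\<close>

lemma const_small:
  assumes "e > 0"
  obtains \<delta> where "\<delta> > 0" "\<Lambda> (\<lambda>_. \<delta>) \<le> e"
proof -
  obtain n :: nat where n: "\<Lambda> (\<lambda>_. 1) / e < real n"
    using reals_Archimedean2 by blast
  have "0 \<le> \<Lambda> (\<lambda>_. 1)"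
    by (rule pos) auto
  then have "0 < real n"
    using n assms by (smt (verit) divide_nonneg_pos)
  then have "real n * \<Lambda> (\<lambda>_. 1 / real n) = \<Lambda> (\<lambda>_. 1)"
    by (subst scale_nat[symmetric]) auto
  moreover have "\<Lambda> (\<lambda>_. 1) < real n * e"
    using n assms by (simp add: field_simps)
  ultimately have "real n * \<Lambda> (\<lambda>_. 1 / real n) < real n * e"
    by simp
  then have "\<Lambda> (\<lambda>_. 1 / real n) < e"
    using \<open>0 < real n\<close> mult_less_cancel_left_pos by blast
  then show ?thesis
    using that[of "1 / real n"] \<open>0 < real n\<close> by simp
qed

text \<open>\<open>K\<close> is compact Hausdorff, hence normal, and Urysohn's lemma
  applies.\<close>

lemma urysohn:
  assumes "closedin (top_of_set K) S" "closedin (top_of_set K) T" "S \<inter> T = {}"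
  obtains g where "continuous_on K g" "\<And>x. x \<in> K \<Longrightarrow> 0 \<le> g x" "\<And>x. x \<in> K \<Longrightarrow> g x \<le> (1::real)"
    "\<And>x. x \<in> S \<Longrightarrow> g x = 1" "\<And>x. x \<in> T \<Longrightarrow> g x = 0"
proof -
  have "normal_space (top_of_set K)"
    using compact_K
    by (intro compact_Hausdorff_or_regular_imp_normal_space disjI1 Hausdorff_space_subtopology)
       (auto simp: compact_space_subtopology Hausdorff_space_def disjnt_def separation_t2)
  then obtain g where "continuous_map (top_of_set K) (top_of_set {0..1}) g" "g ` T \<subseteq> {0}" "g ` S \<subseteq> {1::real}"
    using Urysohn_lemma[of "top_of_set K" T S 0 1] assms by (auto simp: disjnt_def)
  then show ?thesis
    by (intro that[of g]) (auto simp: continuous_map_in_subtopology)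
qed

section \<open>The outer measure induced by the functional\<close>

definition below :: "'b set \<Rightarrow> ('b \<Rightarrow> real) set" where
  "below U = {f. continuous_on K f \<and> (\<forall>x\<in>K. 0 \<le> f x \<and> f x \<le> 1) \<and> (\<forall>x\<in>K - U. f x = 0)}"

definition lower :: "'b set \<Rightarrow> ennreal" where
  "lower U = (SUP f\<in>below U. ennreal (\<Lambda> f))"

text \<open>Outer regularity is built into the definition. If \<open>E\<close> is not a subset of
  \<open>K\<close>, the infimum is over the empty set and the value is \<open>top\<close>;
  Caratheodory's construction only looks at subsets of \<open>K\<close>.\<close>

definition outer :: "'b set \<Rightarrow> ennreal" where
  "outer E = (INF U\<in>{U. openin (top_of_set K) U \<and> E \<subseteq> U}. lower U)"

lemma zero_below: "(\<lambda>x. 0) \<in> below U"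
  by (simp add: below_def)

lemma below_le_lower: "f \<in> below U \<Longrightarrow> ennreal (\<Lambda> f) \<le> lower U"
  unfolding lower_def by (rule SUP_upper)

lemma below_mono: "U \<subseteq> V \<Longrightarrow> below U \<subseteq> below V"
  by (auto simp: below_def)

lemma lower_mono: "U \<subseteq> V \<Longrightarrow> lower U \<le> lower V"
  unfolding lower_def by (intro SUP_subset_mono below_mono) auto

lemma lower_empty: "lower {} = 0"
proof -
  have "ennreal (\<Lambda> f) \<le> 0" if "f \<in> below {}" for f
  proof -
    have "\<Lambda> f \<le> \<Lambda> (\<lambda>x. 0)"
      using that by (intro mono) (auto simp: below_def)
    then show ?thesis
      by (simp add: zero ennreal_neg)
  qed
  then show ?thesis
    unfolding lower_def by (intro antisym SUP_least) auto
qed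

lemma lower_K: "lower K = ennreal (\<Lambda> (\<lambda>x. 1))"
proof (rule antisym)
  show "lower K \<le> ennreal (\<Lambda> (\<lambda>x. 1))"
    unfolding lower_def by (intro SUP_least ennreal_leI mono) (auto simp: below_def)
  show "ennreal (\<Lambda> (\<lambda>x. 1)) \<le> lower K"
    by (rule below_le_lower) (simp add: below_def)
qed

text \<open>\<^term>\<open>below U\<close> does not require the support of a function to lie in \<open>U\<close>; truncating at a small
  positive level recovers this at an arbitrarily small loss of \<open>\<Lambda>\<close>.\<close>

lemma truncate:
  assumes "f \<in> below U" "e > 0"
  obtains \<delta> C where "closedin (top_of_set K) C" "C \<subseteq> U"
    "(\<lambda>x. max 0 (f x - \<delta>)) \<in> below C"
    "\<Lambda> f \<le> \<Lambda> (\<lambda>x. max 0 (f x - \<delta>)) + e"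
proof -
  have f: "continuous_on K f" "\<And>x. x \<in> K \<Longrightarrow> 0 \<le> f x" "\<And>x. x \<in> K \<Longrightarrow> f x \<le> 1"
    "\<And>x. x \<in> K \<Longrightarrow> x \<notin> U \<Longrightarrow> f x = 0"
    using assms(1) by (auto simp: below_def)
  obtain \<delta> where \<delta>: "\<delta> > 0" "\<Lambda> (\<lambda>_. \<delta>) \<le> e"
    using const_small assms(2) by blast
  show ?thesis
  proof (rule that)
    have "{x \<in> K. \<delta> \<le> f x} = K \<inter> f -` {\<delta>..}"
      by auto
    then show "closedin (top_of_set K) {x \<in> K. \<delta> \<le> f x}"
      using continuous_closedin_preimage[OF f(1), of "{\<delta>..}"] by simp
    show "{x \<in> K. \<delta> \<le> f x} \<subseteq> U"
      using f(4) \<delta>(1) by fastforce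
    show "(\<lambda>x. max 0 (f x - \<delta>)) \<in> below {x \<in> K. \<delta> \<le> f x}"
      using f(1) f(3) \<delta>(1) by (fastforce simp: below_def intro!: continuous_intros)
    have "\<Lambda> f \<le> \<Lambda> (\<lambda>x. max 0 (f x - \<delta>) + \<delta>)"
      by (intro mono continuous_intros f) auto
    also have "\<dots> = \<Lambda> (\<lambda>x. max 0 (f x - \<delta>)) + \<Lambda> (\<lambda>_. \<delta>)"
      by (intro add continuous_intros f)
    finally show "\<Lambda> f \<le> \<Lambda> (\<lambda>x. max 0 (f x - \<delta>)) + e"
      using \<delta>(2) by simp
  qed
qed

lemma pos_below: "f \<in> below U \<Longrightarrow> 0 \<le> \<Lambda> f"
  by (rule pos) (auto simp: below_def)

text \<open>By \<open>truncate\<close>, a function in \<open>below U\<close> can be replaced, at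
  loss \<open>e\<close>, by one vanishing outside a relatively closed
  \<open>C \<subseteq> U\<close>, and \<open>e\<close> is arbitrary. The summand \<open>c\<close> is
  \<open>0\<close> for subadditivity and an outer measure for the splitting inequality.\<close>

lemma lower_leI:
  assumes "\<And>f \<delta> C. closedin (top_of_set K) C \<Longrightarrow> C \<subseteq> U \<Longrightarrow>
      (\<lambda>x. max 0 (f x - \<delta>)) \<in> below C \<Longrightarrow> ennreal (\<Lambda> (\<lambda>x. max 0 (f x - \<delta>))) + c \<le> b"
  shows "lower U + c \<le> b"
proof -
  have "ennreal (\<Lambda> f) + c \<le> b" if f: "f \<in> below U" for f
  proof (rule ennreal_le_epsilon)
    fix e :: real assume "0 < e"
    then obtain \<delta> C where *: "closedin (top_of_set K) C" "C \<subseteq> U"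
      "(\<lambda>x. max 0 (f x - \<delta>)) \<in> below C" "\<Lambda> f \<le> \<Lambda> (\<lambda>x. max 0 (f x - \<delta>)) + e"
      by (rule truncate[OF f])
    have "ennreal (\<Lambda> f) \<le> ennreal (\<Lambda> (\<lambda>x. max 0 (f x - \<delta>)) + e)"
      by (intro ennreal_leI *)
    also have "\<dots> = ennreal (\<Lambda> (\<lambda>x. max 0 (f x - \<delta>))) + ennreal e"
      using \<open>0 < e\<close> pos_below[OF *(3)] by simp
    finally have "ennreal (\<Lambda> f) + c \<le> (ennreal (\<Lambda> (\<lambda>x. max 0 (f x - \<delta>))) + c) + ennreal e"
      by (metis add.commute add.left_commute add_left_mono)
    also have "\<dots> \<le> b + ennreal e"
      using assms[OF *(1-3)] by (rule add_right_mono)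
    finally show "ennreal (\<Lambda> f) + c \<le> b + ennreal e" .
  qed
  then have "(SUP f\<in>below U. ennreal (\<Lambda> f) + c) \<le> b"
    by (rule SUP_least)
  then show ?thesis
    \<comment> \<open>Adding \<open>c\<close> commutes with the supremum because
      \<open>below U\<close> is nonempty.\<close>
    unfolding lower_def using zero_below by (subst (asm) ennreal_SUP_add_left) auto
qed

text \<open>A partition of unity: \<open>C - V\<close> and \<open>K - U\<close> are disjoint closed
  sets, so a Urysohn function \<open>g\<close> splits \<open>f'\<close> into \<open>f' * g\<close>,
  which vanishes outside \<open>U\<close>, and \<open>f' * (1 - g)\<close>, which vanishes outside
  \<open>V\<close>.\<close>

lemma lower_Un:
  assumes "openin (top_of_set K) U" "openin (top_of_set K) V"
  shows "lower (U \<union> V) \<le> lower U + lower V"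
proof -
  have "lower (U \<union> V) + 0 \<le> lower U + lower V"
  proof (rule lower_leI)
    fix f \<delta> C assume C: "closedin (top_of_set K) C" "C \<subseteq> U \<union> V"
      and f: "(\<lambda>x. max 0 (f x - \<delta>)) \<in> below C"
    define f' where "f' = (\<lambda>x. max 0 (f x - \<delta>))"
    have f': "continuous_on K f'" "\<And>x. x \<in> K \<Longrightarrow> 0 \<le> f' x" "\<And>x. x \<in> K \<Longrightarrow> f' x \<le> 1"
      "\<And>x. x \<in> K \<Longrightarrow> x \<notin> C \<Longrightarrow> f' x = 0"
      using f by (auto simp: below_def f'_def)
    have "closedin (top_of_set K) (C - V)" "closedin (top_of_set K) (K - U)" "(C - V) \<inter> (K - U) = {}"
      using C assms by (auto intro: closedin_diff)
    then obtain g where g: "continuous_on K g" "\<And>x. x \<in> K \<Longrightarrow> 0 \<le> g x"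
        "\<And>x. x \<in> K \<Longrightarrow> g x \<le> (1::real)" "\<And>x. x \<in> C - V \<Longrightarrow> g x = 1" "\<And>x. x \<in> K - U \<Longrightarrow> g x = 0"
      by (rule urysohn) blast
    have a: "(\<lambda>x. f' x * g x) \<in> below U"
      using f' g by (auto simp: below_def intro!: continuous_intros mult_le_one)
    have "f' x * (1 - g x) = 0" if "x \<in> K" "x \<notin> V" for x
      using f'(4) g(4) that by (cases "x \<in> C") auto
    then have b: "(\<lambda>x. f' x * (1 - g x)) \<in> below V"
      using f' g by (auto simp: below_def intro!: continuous_intros mult_le_one)
    have "\<Lambda> (\<lambda>x. f' x * g x + f' x * (1 - g x)) = \<Lambda> (\<lambda>x. f' x * g x) + \<Lambda> (\<lambda>x. f' x * (1 - g x))"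
      by (intro add continuous_intros f' g)
    then have "\<Lambda> f' = \<Lambda> (\<lambda>x. f' x * g x) + \<Lambda> (\<lambda>x. f' x * (1 - g x))"
      by (simp add: algebra_simps)
    then have "ennreal (\<Lambda> f') = ennreal (\<Lambda> (\<lambda>x. f' x * g x)) + ennreal (\<Lambda> (\<lambda>x. f' x * (1 - g x)))"
      using pos_below[OF a] pos_below[OF b] by simp
    also have "\<dots> \<le> lower U + lower V"
      by (intro add_mono below_le_lower a b)
    finally show "ennreal (\<Lambda> (\<lambda>x. max 0 (f x - \<delta>))) + 0 \<le> lower U + lower V"
      by (simp add: f'_def)
  qed
  then show ?thesis
    by simp
qed

lemma lower_UN_finite:
  assumes "\<And>n. openin (top_of_set K) (U n)"
  shows "lower (\<Union>n<N::nat. U n) \<le> (\<Sum>n<N. lower (U n))"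
proof (induction N)
  case 0
  then show ?case by (simp add: lower_empty)
next
  case (Suc N)
  have "lower ((\<Union>n<N. U n) \<union> U N) \<le> lower (\<Union>n<N. U n) + lower (U N)"
    using assms by (intro lower_Un) auto
  also have "\<dots> \<le> (\<Sum>n<N. lower (U n)) + lower (U N)"
    using Suc by (rule add_right_mono)
  finally show ?case
    by (simp add: lessThan_Suc Un_commute add.commute)
qed

text \<open>The truncated function vanishes outside a closed, hence compact, set \<open>C\<close>,
  which finitely many of the \<open>U n\<close> cover; this reduces the claim to finite
  unions.\<close>

lemma lower_UN:
  assumes "\<And>n. openin (top_of_set K) (U n)"
  shows "lower (\<Union>n::nat. U n) \<le> (\<Sum>n. lower (U n))"
proof -
  have "lower (\<Union>n. U n) + 0 \<le> (\<Sum>n. lower (U n))"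
  proof (rule lower_leI)
    fix f \<delta> C assume C: "closedin (top_of_set K) C" "C \<subseteq> (\<Union>n. U n)"
      and f: "(\<lambda>x. max 0 (f x - \<delta>)) \<in> below C"
    have "compactin (top_of_set K) C"
      using C(1) compact_K by (simp add: closedin_compact_space compact_space_subtopology)
    then obtain F where F: "finite F" "F \<subseteq> range U" "C \<subseteq> \<Union>F"
      using C(2) assms unfolding compactin_def by (metis (no_types, lifting) imageE)
    then obtain I where I: "finite I" "F = U ` I"
      by (meson finite_subset_image)
    then obtain N where "I \<subseteq> {..<N}"
      using finite_nat_iff_bounded by blast
    then have "C \<subseteq> (\<Union>n<N. U n)"
      using F I by blast
    then have "(\<lambda>x. max 0 (f x - \<delta>)) \<in> below (\<Union>n<N. U n)"
      using f below_mono by blast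
    then have "ennreal (\<Lambda> (\<lambda>x. max 0 (f x - \<delta>))) \<le> lower (\<Union>n<N. U n)"
      by (rule below_le_lower)
    also have "\<dots> \<le> (\<Sum>n<N. lower (U n))"
      by (rule lower_UN_finite) (rule assms)
    also have "\<dots> \<le> (\<Sum>n. lower (U n))"
      by (rule sum_le_suminf) auto
    finally show "ennreal (\<Lambda> (\<lambda>x. max 0 (f x - \<delta>))) + 0 \<le> (\<Sum>n. lower (U n))"
      by simp
  qed
  then show ?thesis
    by simp
qed

lemma outer_openin: "openin (top_of_set K) U \<Longrightarrow> outer U = lower U"
  unfolding outer_def by (intro antisym INF_lower INF_greatest lower_mono) auto

lemma outer_mono: "E \<subseteq> F \<Longrightarrow> outer E \<le> outer F"
  unfolding outer_def by (intro INF_superset_mono) auto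

lemma outer_le_lower: "openin (top_of_set K) U \<Longrightarrow> E \<subseteq> U \<Longrightarrow> outer E \<le> lower U"
  unfolding outer_def by (intro INF_lower) auto

text \<open>Choose open \<open>U n\<close> around \<open>E n\<close> with error
  \<open>e / 2^(n+1)\<close>; the errors sum to \<open>e\<close>.\<close>

lemma outer_UN: "outer (\<Union>n::nat. E n) \<le> (\<Sum>n. outer (E n))"
proof (rule ennreal_le_epsilon)
  fix e :: real assume e: "0 < e" and fin: "(\<Sum>n. outer (E n)) < top"
  have "\<exists>U. openin (top_of_set K) U \<and> E n \<subseteq> U \<and> lower U \<le> outer (E n) + ennreal (e * (1/2) ^ Suc n)" for n
  proof -
    \<comment> \<open>Finiteness makes the next inequality strict, so that the infimum has a member
      below the right-hand side.\<close>
    have "outer (E n) \<noteq> top"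
      using fin by (metis ennreal_suminf_lessD less_irrefl)
    then have "outer (E n) < outer (E n) + ennreal (e * (1/2) ^ Suc n)"
      using e by (cases "outer (E n)") (auto simp: ennreal_less_iff simp flip: ennreal_plus)
    then show ?thesis
      unfolding outer_def[of "E n"] INF_less_iff by (auto intro: less_imp_le)
  qed
  then obtain U where U: "\<And>n. openin (top_of_set K) (U n)" "\<And>n. E n \<subseteq> U n"
      "\<And>n. lower (U n) \<le> outer (E n) + ennreal (e * (1/2) ^ Suc n)"
    by metis
  have "outer (\<Union>n. E n) \<le> lower (\<Union>n. U n)"
    using U(1,2) by (intro outer_le_lower) (auto intro!: openin_Union)
  also have "\<dots> \<le> (\<Sum>n. lower (U n))"
    by (intro lower_UN U)
  also have "\<dots> \<le> (\<Sum>n. outer (E n) + ennreal (e * (1/2) ^ Suc n))"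
    by (intro suminf_le U) auto
  also have "\<dots> = (\<Sum>n. outer (E n)) + (\<Sum>n. ennreal (e * (1/2) ^ Suc n))"
    by (intro suminf_add[symmetric]) auto
  also have "(\<Sum>n. ennreal (e * (1/2) ^ Suc n)) = ennreal e"
  proof (rule suminf_ennreal_eq)
    show "(\<lambda>n. e * (1/2) ^ Suc n) sums e"
      using sums_mult[OF power_half_series, of e] by simp
  qed (use e in simp)
  finally show "outer (\<Union>n. E n) \<le> (\<Sum>n. outer (E n)) + ennreal e" .
qed

text \<open>This is the nontrivial Caratheodory inequality for an open test set \<open>U\<close>.
  Let \<open>f'\<close> vanish outside a closed \<open>C \<subseteq> V \<inter> U\<close> and let
  \<open>g\<close> be below the open set \<open>U - C\<close>, which contains \<open>U - V\<close>.
  Then \<open>f' + g\<close> is below \<open>U\<close>, and suprema over \<open>g\<close> and then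
  over \<open>f'\<close> give the claim.\<close>

lemma outer_split_openin:
  assumes U: "openin (top_of_set K) U" and V: "openin (top_of_set K) V"
  shows "lower (V \<inter> U) + outer (U - V) \<le> lower U"
proof (rule lower_leI)
  fix f \<delta> C assume C: "closedin (top_of_set K) C" "C \<subseteq> V \<inter> U"
    and f: "(\<lambda>x. max 0 (f x - \<delta>)) \<in> below C"
  define f' where "f' = (\<lambda>x. max 0 (f x - \<delta>))"
  have f': "f' \<in> below C"
    using f by (simp add: f'_def)
  have W: "openin (top_of_set K) (U - C)"
    using U C by (auto intro: openin_diff)
  have "ennreal (\<Lambda> f') + ennreal (\<Lambda> g) \<le> lower U" if g: "g \<in> below (U - C)" for g
  proof -
    have "(\<lambda>x. f' x + g x) \<in> below U"
      unfolding below_def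
    proof (intro CollectI conjI ballI)
      show "continuous_on K (\<lambda>x. f' x + g x)"
        using f' g by (auto simp: below_def intro!: continuous_intros)
      fix x assume x: "x \<in> K"
      show "0 \<le> f' x + g x"
        using f' g x by (auto simp: below_def)
      \<comment> \<open>\<open>f'\<close> vanishes outside \<open>C\<close> and \<open>g\<close>
        vanishes on \<open>C\<close>, so the sum stays at most \<open>1\<close>.\<close>
      have "f' x = 0 \<or> g x = 0"
        using f' g x by (auto simp: below_def)
      then show "f' x + g x \<le> 1"
        using f' g x by (auto simp: below_def)
    next
      fix x assume "x \<in> K - U"
      then show "f' x + g x = 0"
        using f' g C(2) by (auto simp: below_def)
    qed
    then have "ennreal (\<Lambda> (\<lambda>x. f' x + g x)) \<le> lower U"
      by (rule below_le_lower)
    moreover have "\<Lambda> (\<lambda>x. f' x + g x) = \<Lambda> f' + \<Lambda> g"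
      using f' g by (intro add) (auto simp: below_def)
    ultimately show ?thesis
      using pos_below[OF f'] pos_below[OF g] by simp
  qed
  then have "(SUP g\<in>below (U - C). ennreal (\<Lambda> f') + ennreal (\<Lambda> g)) \<le> lower U"
    by (rule SUP_least)
  then have "ennreal (\<Lambda> f') + lower (U - C) \<le> lower U"
    unfolding lower_def[of "U - C"] using zero_below by (subst ennreal_SUP_add_right) auto
  moreover have "outer (U - V) \<le> lower (U - C)"
    using W C(2) by (intro outer_le_lower) auto
  ultimately show "ennreal (\<Lambda> (\<lambda>x. max 0 (f x - \<delta>))) + outer (U - V) \<le> lower U"
    unfolding f'_def by (meson add_left_mono order_trans)
qed

section \<open>Caratheodory's construction of the Borel measure\<close>

lemma outer_measure_space_outer: "outer_measure_space (Pow K) outer"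
  unfolding outer_measure_space_def
proof (intro conjI)
  show "positive (Pow K) outer"
    using outer_openin[of "{}"] by (simp add: positive_def lower_empty)
  show "increasing (Pow K) outer"
    by (simp add: increasing_def outer_mono)
  show "countably_subadditive (Pow K) outer"
    by (simp add: countably_subadditive_def outer_UN)
qed

text \<open>Replacing the test set \<open>E\<close> by the open sets containing it reduces one
  inequality to \<open>outer_split_openin\<close>; the other is subadditivity.\<close>

lemma openin_lambda_system:
  assumes V: "openin (top_of_set K) V"
  shows "V \<in> lambda_system K (Pow K) outer"
  unfolding lambda_system_def
proof (intro CollectI conjI ballI)
  show "V \<in> Pow K"
    using V openin_imp_subset by blast
  fix E assume "E \<in> Pow K"
  then have E: "E \<subseteq> K" by simp
  show "outer (V \<inter> E) + outer ((K - V) \<inter> E) = outer E"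
  proof (rule antisym)
    have "outer (V \<inter> E) + outer ((K - V) \<inter> E) \<le> lower U" if "openin (top_of_set K) U" "E \<subseteq> U" for U
    proof -
      have "outer (V \<inter> E) \<le> lower (V \<inter> U)"
        using that V by (intro outer_le_lower) auto
      moreover have "outer ((K - V) \<inter> E) \<le> outer (U - V)"
        using that by (intro outer_mono) auto
      ultimately show ?thesis
        using outer_split_openin[OF that(1) V] by (meson add_mono order_trans)
    qed
    then show "outer (V \<inter> E) + outer ((K - V) \<inter> E) \<le> outer E"
      unfolding outer_def[of E] by (intro INF_greatest) auto
    \<comment> \<open>The two pieces are padded with empty sets, of outer measure \<open>0\<close>,
      to fit countable subadditivity.\<close>
    define F where "F n = (if n = 0 then V \<inter> E else if n = 1 then (K - V) \<inter> E else {})" for n :: nat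
    have "E \<subseteq> (\<Union>n. F n)"
    proof
      fix x assume "x \<in> E"
      then have "x \<in> F 0 \<or> x \<in> F 1"
        using E by (auto simp: F_def)
      then show "x \<in> (\<Union>n. F n)" by blast
    qed
    then have "outer E \<le> (\<Sum>n. outer (F n))"
      using outer_mono outer_UN order_trans by blast
    also have "\<dots> = (\<Sum>n<2. outer (F n))"
      using outer_openin[of "{}"] by (intro suminf_finite) (auto simp: F_def lower_empty)
    also have "\<dots> = outer (V \<inter> E) + outer ((K - V) \<inter> E)"
      by (simp add: numeral_2_eq_2 F_def)
    finally show "outer E \<le> outer (V \<inter> E) + outer ((K - V) \<inter> E)" .
  qed
qed

text \<open>\<open>measure_of\<close> takes its values from \<open>outer\<close> only if
  \<open>outer\<close> is a measure on these sets; \<open>emeasure_riesz\<close> establishes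
  this.\<close>

definition riesz :: "'b measure" where
  "riesz = measure_of K (sets (restrict_space borel K)) outer"

lemma space_borel_K: "space (restrict_space borel K) = K"
  by (simp add: space_restrict_space)

lemma sets_riesz: "sets riesz = sets (restrict_space borel K)"
  using sets.sets_measure_of_eq[of "restrict_space borel K" outer] unfolding riesz_def space_borel_K .

lemma space_riesz: "space riesz = K"
  using sets_eq_imp_space_eq[OF sets_riesz] by (simp add: space_borel_K)

text \<open>By Caratheodory the lambda system is a sigma-algebra, and it contains the relatively
  open sets. The induction runs over Borel sets \<open>B\<close> of the ambient space and treats
  their traces \<open>K \<inter> B\<close>.\<close>

lemma borel_subset_lambda_system:
  "sets (restrict_space borel K) \<subseteq> lambda_system K (Pow K) outer"
proof -
  have "measure_space K (lambda_system K (Pow K) outer) outer"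
    using sigma_algebra.caratheodory_lemma[OF sigma_algebra_Pow outer_measure_space_outer] .
  then interpret LS: sigma_algebra K "lambda_system K (Pow K) outer"
    by (simp add: measure_space_def)
  have "K \<inter> B \<in> lambda_system K (Pow K) outer" if "B \<in> sigma_sets UNIV {S. open S}" for B
    using that
  proof (induction B)
    case (Basic S)
    then show ?case
      by (intro openin_lambda_system) (auto simp: openin_open)
  next
    case (Compl S)
    have "K \<inter> (UNIV - S) = K - K \<inter> S" by auto
    then show ?case using LS.compl_sets[OF Compl.IH] by simp
  next
    case (Union S)
    have "K \<inter> (\<Union>n. S n) = (\<Union>n. K \<inter> S n)" by auto
    moreover have "(\<Union>n. K \<inter> S n) \<in> lambda_system K (Pow K) outer"
      using Union.IH by (intro LS.countable_UN) blast
    ultimately show ?case by simp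
  qed simp
  then show ?thesis
    unfolding sets_restrict_space sets_borel by blast
qed

lemma emeasure_riesz:
  assumes "A \<in> sets (restrict_space borel K)"
  shows "emeasure riesz A = outer A"
proof -
  have "measure_space K (sets (restrict_space borel K)) outer"
    using sigma_algebra.caratheodory_lemma[OF sigma_algebra_Pow outer_measure_space_outer]
      sets.sigma_algebra_axioms[of "restrict_space borel K"] borel_subset_lambda_system
    unfolding space_borel_K by (rule measure_down)
  then show ?thesis
    unfolding riesz_def using assms
    by (intro emeasure_measure_of_sigma) (auto simp: measure_space_def)
qed

lemma sets_riesz_openin: "openin (top_of_set K) U \<Longrightarrow> U \<in> sets riesz"
  unfolding sets_riesz sets_restrict_space openin_open by auto

lemma emeasure_riesz_openin: "openin (top_of_set K) U \<Longrightarrow> emeasure riesz U = lower U"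
  using emeasure_riesz sets_riesz_openin by (simp add: sets_riesz outer_openin)

lemma finite_measure_riesz: "finite_measure riesz"
  by (rule finite_measureI) (simp add: space_riesz emeasure_riesz_openin lower_K)

lemma measure_riesz_K: "measure riesz K = \<Lambda> (\<lambda>x. 1)"
  using pos[of "\<lambda>x. 1"] by (simp add: measure_def emeasure_riesz_openin lower_K)

section \<open>The functional as an integral\<close>

lemma integrable_riesz:
  fixes f :: "'b \<Rightarrow> real"
  assumes "continuous_on K f"
  shows "integrable riesz f"
proof -
  have "bounded (f ` K)"
    using compact_K assms compact_continuous_image compact_imp_bounded by blast
  then obtain B where "\<And>x. x \<in> K \<Longrightarrow> norm (f x) \<le> B"
    unfolding bounded_iff by blast
  moreover have "f \<in> borel_measurable riesz"
    using borel_measurable_continuous_on_restrict[OF assms] measurable_cong_sets[OF sets_riesz refl] by blast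
  ultimately show ?thesis
    using finite_measure_riesz
    by (intro finite_measure.integrable_const_bound[of _ _ B] AE_I2) (auto simp: space_riesz)
qed

text \<open>The interval from \<open>0\<close> to \<open>t\<close> is cut into slices of height
  \<open>c\<close>; the summand with index \<open>k\<close> is the length of its part between
  \<open>k * c\<close> and \<open>(k + 1) * c\<close>.\<close>

lemma sum_layers:
  fixes c t :: real
  assumes "c \<ge> 0" "t \<ge> 0"
  shows "(\<Sum>k<n. min c (max 0 (t - real k * c))) = min t (real n * c)"
proof (induction n)
  case 0
  then show ?case using assms by simp
next
  case (Suc n)
  have "real (Suc n) * c = real n * c + c" by (simp add: algebra_simps)
  then show ?case using Suc assms by (simp add: min_def max_def)
qed

text \<open>Each layer \<open>min (1/n) (max 0 (f - k/n))\<close> lies between \<open>1/n\<close> times the indicators of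
  \<open>{f > (k+1)/n}\<close> and of \<open>{f > k/n}\<close>, so that the two sums telescope against each other.\<close>

lemma le_integral_unit:
  assumes f: "continuous_on K f" "\<And>x. x \<in> K \<Longrightarrow> 0 \<le> f x" "\<And>x. x \<in> K \<Longrightarrow> f x \<le> 1"
    and n: "n > 0"
  shows "\<Lambda> f \<le> (\<integral>x. f x \<partial>riesz) + \<Lambda> (\<lambda>x. 1) / real n"
proof -
  interpret finite_measure riesz by (rule finite_measure_riesz)
  define g where "g k x = min (1 / real n) (max 0 (f x - real k * (1 / real n)))" for k x
  define U where "U k = {x \<in> K. real k * (1 / real n) < f x}" for k
  have g: "continuous_on K (g k)" for k
    unfolding g_def by (intro continuous_intros f)
  have sum_g: "(\<Sum>k<n. g k x) = f x" if "x \<in> K" for x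
    unfolding g_def using sum_layers[of "1 / real n" "f x" n] f that n by simp
  have U: "openin (top_of_set K) (U k)" for k
  proof -
    have "U k = K \<inter> f -` {real k * (1 / real n)<..}"
      by (auto simp: U_def)
    then show ?thesis
      using continuous_openin_preimage_gen[OF f(1), of "{real k * (1 / real n)<..}"] by simp
  qed
  have upper: "real n * \<Lambda> (g k) \<le> measure riesz (U k)" for k
  proof -
    have "(\<lambda>x. real n * g k x) \<in> below (U k)"
      unfolding below_def
    proof (intro CollectI conjI ballI)
      show "continuous_on K (\<lambda>x. real n * g k x)"
        by (intro continuous_intros g)
      fix x assume "x \<in> K"
      show "0 \<le> real n * g k x"
        by (simp add: g_def)
      have "real n * g k x \<le> real n * (1 / real n)"
        by (intro mult_left_mono) (auto simp: g_def)
      then show "real n * g k x \<le> 1"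
        using n by simp
    qed (auto simp: g_def U_def)
    then have "ennreal (\<Lambda> (\<lambda>x. real n * g k x)) \<le> ennreal (measure riesz (U k))"
      using below_le_lower by (metis emeasure_riesz_openin[OF U] emeasure_eq_measure)
    then show ?thesis
      using scale_nat[OF g] by (simp add: ennreal_le_iff)
  qed
  have lower: "measure riesz (U (Suc k)) \<le> real n * (\<integral>x. g k x \<partial>riesz)" for k
  proof -
    have "measure riesz (U (Suc k)) = (\<integral>x. indicator (U (Suc k)) x \<partial>riesz)"
      using sets_riesz_openin[OF U] sets.sets_into_space by (simp add: Int_absorb2)
    also have "\<dots> \<le> (\<integral>x. real n * g k x \<partial>riesz)"
    proof (rule integral_mono)
      show "integrable riesz (indicator (U (Suc k)) :: 'b \<Rightarrow> real)"
        using sets_riesz_openin[OF U] by (simp add: emeasure_eq_measure)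
      show "integrable riesz (\<lambda>x. real n * g k x)"
        by (intro integrable_mult_right integrable_riesz g)
      fix x
      show "indicator (U (Suc k)) x \<le> real n * g k x"
      proof (cases "x \<in> U (Suc k)")
        case True
        then have "f x - real k * (1 / real n) \<ge> 1 / real n"
          by (simp add: U_def add_divide_distrib)
        then have "g k x = 1 / real n"
          by (simp add: g_def)
        then show ?thesis
          using n True by simp
      qed (simp add: g_def)
    qed
    finally show ?thesis by simp
  qed
  have "real n * \<Lambda> f = (\<Sum>k<n. real n * \<Lambda> (g k))"
  proof -
    have "\<Lambda> f = \<Lambda> (\<lambda>x. \<Sum>k<n. g k x)"
      by (intro antisym mono f continuous_intros g) (simp_all add: sum_g)
    then show ?thesis
      using sum[of n g] g by (simp add: sum_distrib_left)
  qed
  \<comment> \<open>The extra term for \<open>U n\<close> allows an index shift to the sets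
    \<open>U (Suc k)\<close>, which \<open>lower\<close> bounds. What remains is the measure of
    \<open>U 0\<close>, at most the total mass; division by \<open>n\<close> turns it into the error
    term.\<close>
  also have "\<dots> \<le> (\<Sum>k<Suc n. measure riesz (U k))"
    by (intro order_trans[OF sum_mono[OF upper]]) auto
  also have "\<dots> = measure riesz (U 0) + (\<Sum>k<n. measure riesz (U (Suc k)))"
    by (rule sum.lessThan_Suc_shift)
  also have "\<dots> \<le> \<Lambda> (\<lambda>x. 1) + (\<Sum>k<n. real n * (\<integral>x. g k x \<partial>riesz))"
    using bounded_measure[of "U 0"] by (intro add_mono sum_mono lower) (simp add: space_riesz measure_riesz_K)
  also have "(\<Sum>k<n. real n * (\<integral>x. g k x \<partial>riesz)) = real n * (\<integral>x. (\<Sum>k<n. g k x) \<partial>riesz)"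
    by (simp add: sum_distrib_left integrable_riesz g)
  also have "(\<integral>x. (\<Sum>k<n. g k x) \<partial>riesz) = (\<integral>x. f x \<partial>riesz)"
    by (intro Bochner_Integration.integral_cong) (auto simp: space_riesz sum_g)
  finally show ?thesis
    using n by (simp add: field_simps)
qed

text \<open>Letting \<open>n\<close> tend to infinity in \<open>le_integral_unit\<close> gives one
  inequality. The same inequality for \<open>1 - f\<close> gives the other, as the total mass is
  \<open>\<Lambda> 1\<close>.\<close>

lemma eq_integral_unit:
  assumes f: "continuous_on K f" "\<And>x. x \<in> K \<Longrightarrow> 0 \<le> f x" "\<And>x. x \<in> K \<Longrightarrow> f x \<le> 1"
  shows "\<Lambda> f = (\<integral>x. f x \<partial>riesz)"
proof -
  interpret finite_measure riesz by (rule finite_measure_riesz)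
  have le: "\<Lambda> g \<le> (\<integral>x. g x \<partial>riesz)"
    if "continuous_on K g" "\<And>x. x \<in> K \<Longrightarrow> 0 \<le> g x" "\<And>x. x \<in> K \<Longrightarrow> g x \<le> 1" for g
  proof (rule LIMSEQ_le_const)
    have "(\<lambda>n. (\<integral>x. g x \<partial>riesz) + \<Lambda> (\<lambda>x. 1) / real n) \<longlonglongrightarrow> (\<integral>x. g x \<partial>riesz) + 0"
      by (intro tendsto_intros lim_const_over_n)
    then show "(\<lambda>n. (\<integral>x. g x \<partial>riesz) + \<Lambda> (\<lambda>x. 1) / real n) \<longlonglongrightarrow> (\<integral>x. g x \<partial>riesz)"
      by simp
    show "\<exists>N. \<forall>n\<ge>N. \<Lambda> g \<le> (\<integral>x. g x \<partial>riesz) + \<Lambda> (\<lambda>x. 1) / real n"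
      using le_integral_unit[OF that] by (intro exI[of _ 1]) auto
  qed
  have "\<Lambda> (\<lambda>x. 1) - \<Lambda> f = \<Lambda> (\<lambda>x. 1 - f x)"
    by (intro diff[symmetric] continuous_intros f)
  also have "\<dots> \<le> (\<integral>x. 1 - f x \<partial>riesz)"
    using f by (intro le continuous_intros) auto
  also have "\<dots> = \<Lambda> (\<lambda>x. 1) - (\<integral>x. f x \<partial>riesz)"
    by (simp add: integrable_riesz f measure_riesz_K space_riesz)
  finally show ?thesis
    using le[OF f] by simp
qed

theorem eq_integral:
  assumes f: "continuous_on K f"
  shows "\<Lambda> f = (\<integral>x. f x \<partial>riesz)"
proof -
  interpret finite_measure riesz by (rule finite_measure_riesz)
  have "bounded (f ` K)"
    using compact_K assms compact_continuous_image compact_imp_bounded by blast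
  then obtain B where B: "\<And>x. x \<in> K \<Longrightarrow> \<bar>f x\<bar> \<le> B"
    unfolding bounded_iff by auto
  obtain n :: nat where "max B 1 < real n"
    using reals_Archimedean2 by blast
  then have n: "B < real n" "0 < real n"
    by auto
  \<comment> \<open>An affine change moves \<open>f\<close> into the unit interval. Its coefficients
    come from a natural number \<open>n\<close> so that \<open>scale_nat\<close> can undo
    it.\<close>
  define g where "g x = (f x / real n + 1) / 2" for x
  have cont: "continuous_on K g"
    unfolding g_def by (intro continuous_intros f) (use n in auto)
  have "0 \<le> g x \<and> g x \<le> 1" if "x \<in> K" for x
    using B[OF that] n unfolding g_def by (auto simp: field_simps abs_le_iff)
  then have g: "\<Lambda> g = (\<integral>x. g x \<partial>riesz)"
    using cont by (intro eq_integral_unit) auto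
  have f_eq: "f = (\<lambda>x. real (2 * n) * g x - real n * 1)"
    using n by (auto simp: g_def fun_eq_iff field_simps)
  have "\<Lambda> f = real (2 * n) * \<Lambda> g - real n * \<Lambda> (\<lambda>x. 1)"
    using diff[of "\<lambda>x. real (2 * n) * g x" "\<lambda>x. real n * 1"] scale_nat[OF cont, of "2 * n"] scale_nat[of "\<lambda>x. 1" n] cont
    by (subst f_eq) (simp add: continuous_on_mult_left)
  also have "\<dots> = (\<integral>x. real (2 * n) * g x - real n * 1 \<partial>riesz)"
    by (simp add: g integrable_riesz cont measure_riesz_K space_riesz)
  finally show ?thesis
    using f_eq by simp
qed

end

section \<open>Extension of the functional to the continuous functions\<close>

context
  fixes h :: "'a::comm_ring_1" and K :: "('a \<Rightarrow> real) set"
  assumes h: "2 * h = 1" and K: "K \<subseteq> real_homs" and compact_K: "compact K"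
begin

section \<open>Homomorphisms on \<open>K\<close> and density of the evaluations\<close>

lemma hom_add: "\<alpha> \<in> K \<Longrightarrow> \<alpha> (a + b) = \<alpha> a + \<alpha> b"
  and hom_mult: "\<alpha> \<in> K \<Longrightarrow> \<alpha> (a * b) = \<alpha> a * \<alpha> b"
  and hom_1: "\<alpha> \<in> K \<Longrightarrow> \<alpha> 1 = 1"
  using K by (auto simp: real_homs_def)

lemma hom_0: "\<alpha> \<in> K \<Longrightarrow> \<alpha> 0 = 0"
  using hom_add[of \<alpha> 0 0] by simp

lemma hom_minus: "\<alpha> \<in> K \<Longrightarrow> \<alpha> (- a) = - \<alpha> a"
  using hom_add[of \<alpha> a "- a"] hom_0[of \<alpha>] by simp

lemma hom_diff: "\<alpha> \<in> K \<Longrightarrow> \<alpha> (a - b) = \<alpha> a - \<alpha> b"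
  using hom_add[of \<alpha> a "- b"] hom_minus by simp

lemma hom_power: "\<alpha> \<in> K \<Longrightarrow> \<alpha> (a ^ n) = \<alpha> a ^ n"
  by (induction n) (auto simp: hom_1 hom_mult)

lemma hom_of_nat: "\<alpha> \<in> K \<Longrightarrow> \<alpha> (of_nat n) = real n"
  by (induction n) (auto simp: hom_0 hom_1 hom_add)

lemma hom_of_int: "\<alpha> \<in> K \<Longrightarrow> \<alpha> (of_int m) = of_int m"
  by (cases m rule: int_diff_cases) (auto simp: hom_diff hom_of_nat)

lemma hom_h: "\<alpha> \<in> K \<Longrightarrow> \<alpha> h = 1 / 2"
  using h hom_mult[of \<alpha> 2 h] hom_of_nat[of \<alpha> 2] hom_1[of \<alpha>] by simp

lemma hom_dyadic: "\<alpha> \<in> K \<Longrightarrow> \<alpha> (of_int m * h ^ k) = of_int m / 2 ^ k"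
  by (simp add: hom_mult hom_of_int hom_power hom_h power_divide)

lemma hat_eq: "\<alpha> \<in> K \<Longrightarrow> hat a \<alpha> = \<alpha> a"
  using K by (auto simp: hat_def)

lemma continuous_on_eval: "continuous_on K (\<lambda>\<alpha>. \<alpha> a)"
  by (rule continuous_on_subset[OF continuous_on_product_coordinates]) auto

lemma seminorm_on_le:
  assumes "0 \<le> c" "\<And>\<alpha>. \<alpha> \<in> K \<Longrightarrow> \<bar>\<alpha> a\<bar> \<le> c"
  shows "seminorm_on K a \<le> c"
  unfolding seminorm_on_def using assms by (intro cSup_least) (auto simp: hat_eq)

lemma power_half_less:
  assumes "(e::real) > 0"
  obtains k where "(1/2) ^ k < e"
  using real_arch_pow_inv[OF assms, of "1/2"] by auto

text \<open>Stone-Weierstrass on \<open>K\<close>: evaluations separate points, since distinct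
  homomorphisms differ at some ring element.\<close>

lemma hom_dense:
  assumes "continuous_on K f" "e > 0"
  obtains a where "\<And>\<alpha>. \<alpha> \<in> K \<Longrightarrow> \<bar>f \<alpha> - \<alpha> a\<bar> < e"
proof -
  \<comment> \<open>The uniform closure of the evaluations is used because a function ring must
    contain all real constants, while the ring elements \<open>of_int m * h ^ k\<close> supply the
    dyadic ones.\<close>
  define R where "R = {f. continuous_on K f \<and> (\<forall>e>0. \<exists>a. \<forall>\<alpha>\<in>K. \<bar>f \<alpha> - \<alpha> a\<bar> < e)}"
  have eval: "(\<lambda>\<alpha>. \<alpha> a) \<in> R" for a
    unfolding R_def using continuous_on_eval by (auto intro!: exI[of _ a])
  interpret function_ring_on R K
  proof
    show "compact K" by (rule compact_K)
    show "continuous_on K f" if "f \<in> R" for f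
      using that by (simp add: R_def)
    show "(\<lambda>x. f x + g x) \<in> R" if f: "f \<in> R" and g: "g \<in> R" for f g
      unfolding R_def
    proof (intro CollectI conjI allI impI)
      show "continuous_on K (\<lambda>x. f x + g x)"
        using f g by (auto simp: R_def intro: continuous_intros)
      fix e :: real assume "e > 0"
      then have "e / 2 > 0" by simp
      then obtain a b where "\<forall>\<alpha>\<in>K. \<bar>f \<alpha> - \<alpha> a\<bar> < e / 2" "\<forall>\<alpha>\<in>K. \<bar>g \<alpha> - \<alpha> b\<bar> < e / 2"
        using f g unfolding R_def by blast
      then have "\<bar>f \<alpha> + g \<alpha> - \<alpha> (a + b)\<bar> < e" if "\<alpha> \<in> K" for \<alpha>
        unfolding hom_add[OF that] using that by (smt (verit) field_sum_of_halves)
      then show "\<exists>a. \<forall>\<alpha>\<in>K. \<bar>f \<alpha> + g \<alpha> - \<alpha> a\<bar> < e" by blast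
    qed
    show "(\<lambda>x. f x * g x) \<in> R" if f: "f \<in> R" and g: "g \<in> R" for f g
      unfolding R_def
    proof (intro CollectI conjI allI impI)
      have cont: "continuous_on K f" "continuous_on K g"
        using f g by (auto simp: R_def)
      show "continuous_on K (\<lambda>x. f x * g x)"
        by (intro continuous_intros cont)
      fix e :: real assume e: "e > 0"
      have "bounded (f ` K)" "bounded (g ` K)"
        using compact_K cont compact_continuous_image compact_imp_bounded by blast+
      then obtain B C where B: "\<And>x. x \<in> K \<Longrightarrow> \<bar>f x\<bar> \<le> B" and C: "\<And>x. x \<in> K \<Longrightarrow> \<bar>g x\<bar> \<le> C"
        unfolding bounded_iff by auto
      \<comment> \<open>With \<open>d \<le> 1\<close> the approximant of \<open>g\<close> is bounded
        by \<open>\<bar>C\<bar> + 1\<close>, so the error of the product is at most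
        \<open>M * d\<close>; the factor \<open>2\<close> in \<open>d\<close> makes the final bound
        strict.\<close>
      define M where "M = \<bar>B\<bar> + \<bar>C\<bar> + 1"
      define d where "d = min 1 (e / (2 * M))"
      have M: "M > 0"
        by (simp add: M_def add_nonneg_pos)
      have "d \<le> e / (2 * M)"
        by (simp add: d_def)
      then have "2 * M * d \<le> e"
        using M by (simp add: pos_le_divide_eq mult.commute)
      moreover have "d > 0" "d \<le> 1"
        using e M by (simp_all add: d_def)
      ultimately have d: "d > 0" "d \<le> 1" "2 * M * d \<le> e"
        by blast+
      obtain a where a: "\<forall>\<alpha>\<in>K. \<bar>f \<alpha> - \<alpha> a\<bar> < d"
        using f d(1) unfolding R_def by blast
      obtain b where b: "\<forall>\<alpha>\<in>K. \<bar>g \<alpha> - \<alpha> b\<bar> < d"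
        using g d(1) unfolding R_def by blast
      have "\<bar>f \<alpha> * g \<alpha> - \<alpha> (a * b)\<bar> < e" if \<alpha>: "\<alpha> \<in> K" for \<alpha>
      proof -
        have "\<bar>f \<alpha> * g \<alpha> - \<alpha> (a * b)\<bar> = \<bar>f \<alpha> * (g \<alpha> - \<alpha> b) + (f \<alpha> - \<alpha> a) * \<alpha> b\<bar>"
          by (simp add: hom_mult \<alpha> algebra_simps)
        also have "\<dots> \<le> \<bar>f \<alpha>\<bar> * \<bar>g \<alpha> - \<alpha> b\<bar> + \<bar>f \<alpha> - \<alpha> a\<bar> * \<bar>\<alpha> b\<bar>"
          by (metis abs_mult abs_triangle_ineq)
        also have "\<dots> \<le> \<bar>B\<bar> * d + d * (\<bar>C\<bar> + 1)"
        proof (intro add_mono mult_mono)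
          have "\<bar>f \<alpha> - \<alpha> a\<bar> < d" "\<bar>g \<alpha> - \<alpha> b\<bar> < d"
            using a b \<alpha> by auto
          then show "\<bar>f \<alpha>\<bar> \<le> \<bar>B\<bar>" "\<bar>g \<alpha> - \<alpha> b\<bar> \<le> d" "\<bar>f \<alpha> - \<alpha> a\<bar> \<le> d" "\<bar>\<alpha> b\<bar> \<le> \<bar>C\<bar> + 1"
            using B[OF \<alpha>] C[OF \<alpha>] d by linarith+
        qed (use d in auto)
        also have "\<dots> = M * d"
          by (simp add: M_def algebra_simps)
        also have "\<dots> < 2 * M * d"
          using M d by simp
        finally show ?thesis
          using d by simp
      qed
      then show "\<exists>a. \<forall>\<alpha>\<in>K. \<bar>f \<alpha> * g \<alpha> - \<alpha> a\<bar> < e" by blast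
    qed
    show "(\<lambda>_. c) \<in> R" for c
      unfolding R_def
    proof (intro CollectI conjI allI impI)
      fix e :: real assume "e > 0"
      then obtain k where k: "(1/2) ^ k < e"
        by (rule power_half_less)
      \<comment> \<open>The constant \<open>c\<close> is rounded down to a multiple of
        \<open>1 / 2^k\<close>, which is the value of a ring element at every point of
        \<open>K\<close>.\<close>
      have "c - of_int \<lfloor>c * 2 ^ k\<rfloor> / 2 ^ k = (c * 2 ^ k - of_int \<lfloor>c * 2 ^ k\<rfloor>) / 2 ^ k"
        by (simp add: diff_divide_distrib)
      then have "\<bar>c - of_int \<lfloor>c * 2 ^ k\<rfloor> / 2 ^ k\<bar> = \<bar>c * 2 ^ k - of_int \<lfloor>c * 2 ^ k\<rfloor>\<bar> / 2 ^ k"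
        by simp
      also have "\<dots> \<le> 1 / 2 ^ k"
        by (intro divide_right_mono) (linarith, simp)
      finally have "\<bar>c - of_int \<lfloor>c * 2 ^ k\<rfloor> / 2 ^ k\<bar> \<le> (1/2) ^ k"
        by (simp add: power_divide)
      then show "\<exists>a. \<forall>\<alpha>\<in>K. \<bar>c - \<alpha> a\<bar> < e"
        using k by (intro exI[of _ "of_int \<lfloor>c * 2 ^ k\<rfloor> * h ^ k"]) (auto simp: hom_dyadic)
    qed simp
    show "\<exists>f\<in>R. f x \<noteq> f y" if xy: "x \<noteq> y" for x y
    proof -
      obtain a where "x a \<noteq> y a"
        using xy by blast
      then show ?thesis
        using eval[of a] by (intro bexI[of _ "\<lambda>\<alpha>. \<alpha> a"]) auto
    qed
  qed
  obtain g where "g \<in> R" and g: "\<forall>x\<in>K. \<bar>f x - g x\<bar> < e / 2"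
    using Stone_Weierstrass_basic[OF assms(1), of "e / 2"] assms(2) by auto
  moreover have "e / 2 > 0"
    using assms(2) by simp
  ultimately obtain a where "\<forall>\<alpha>\<in>K. \<bar>g \<alpha> - \<alpha> a\<bar> < e / 2"
    unfolding R_def by blast
  then have "\<bar>f \<alpha> - \<alpha> a\<bar> < e" if "\<alpha> \<in> K" for \<alpha>
    using g that by (smt (verit) field_sum_of_halves)
  then show ?thesis
    by (rule that)
qed

context
  fixes d :: nat and L :: "'a \<Rightarrow> real"
  assumes d: "d \<ge> 1"
    and L_cont: "continuous_map (seminorm_topology K) euclideanreal L"
    and L_lin: "dyadic_linear h L"
    and L_power: "\<And>a. L (a ^ (2 * d)) \<ge> 0"
begin

section \<open>Positivity of \<open>L\<close> on elements nonnegative on \<open>K\<close>\<close>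

lemma L_add: "L (a + b) = L a + L b"
  using L_lin by (auto simp: dyadic_linear_def)

lemma L_0: "L 0 = 0"
  using L_add[of 0 0] by simp

lemma L_minus: "L (- a) = - L a"
  using L_add[of a "- a"] by (simp add: L_0)

lemma L_diff: "L (a - b) = L a - L b"
  using L_add[of a "- b"] L_minus by simp

lemma L_h_power: "L (h ^ k) = (1/2) ^ k * L 1"
proof -
  have "L (of_int 1 * h ^ k * 1) = (of_int 1 / 2 ^ k) * L 1"
    using L_lin unfolding dyadic_linear_def by blast
  then show ?thesis
    by (simp add: power_divide)
qed

text \<open>This is continuity at \<open>0\<close>, restated with pointwise bounds on
  \<open>K\<close>.\<close>

lemma L_small:
  assumes "e > 0"
  obtains \<delta> where "\<delta> > 0" "\<And>a. (\<And>\<alpha>. \<alpha> \<in> K \<Longrightarrow> \<bar>\<alpha> a\<bar> < \<delta>) \<Longrightarrow> \<bar>L a\<bar> < e"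
proof -
  have top: "topspace (seminorm_topology K) = UNIV"
    using openin_subset[of "seminorm_topology K" UNIV]
    by (auto simp: openin_seminorm_topology gt_ex)
  have "openin (seminorm_topology K) {a \<in> topspace (seminorm_topology K). L a \<in> {-e<..<e}}"
    using L_cont by (rule openin_continuous_map_preimage) simp
  then have "openin (seminorm_topology K) {a. L a \<in> {-e<..<e}}"
    by (simp add: top)
  moreover have "0 \<in> {a. L a \<in> {-e<..<e}}"
    using assms by (simp add: L_0)
  ultimately obtain \<delta> where \<delta>: "\<delta> > 0" "{b. seminorm_on K (0 - b) < \<delta>} \<subseteq> {a. L a \<in> {-e<..<e}}"
    unfolding openin_seminorm_topology by blast
  show ?thesis
  proof
    \<comment> \<open>Pointwise strict bounds only give a weak bound on the supremum; halving
      \<open>\<delta>\<close> restores strictness.\<close>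
    show "\<delta> / 2 > 0" using \<delta>(1) by simp
    fix a assume a: "\<And>\<alpha>. \<alpha> \<in> K \<Longrightarrow> \<bar>\<alpha> a\<bar> < \<delta> / 2"
    have "seminorm_on K (0 - a) \<le> \<delta> / 2"
      using \<delta>(1) a by (intro seminorm_on_le) (auto simp: hom_minus intro: less_imp_le)
    then have "a \<in> {b. seminorm_on K (0 - b) < \<delta>}"
      using \<delta>(1) by simp
    then have "L a \<in> {-e<..<e}"
      using \<delta>(2) by blast
    then show "\<bar>L a\<bar> < e"
      by auto
  qed
qed

text \<open>The root of order \<open>2 * d\<close> of \<open>a\<close> is continuous on
  \<open>K\<close>. If a ring element \<open>b\<close> approximates it well,
  \<open>a - b ^ n\<close> is small on \<open>K\<close>, hence \<open>L a\<close> exceeds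
  \<open>L (b ^ n) - e\<close>, which is at least \<open>- e\<close>.\<close>

lemma L_nonneg:
  assumes a: "\<And>\<alpha>. \<alpha> \<in> K \<Longrightarrow> 0 \<le> \<alpha> a"
  shows "0 \<le> L a"
proof (rule field_le_epsilon)
  fix e :: real assume "e > 0"
  then obtain \<delta> where \<delta>: "\<delta> > 0" "\<And>a. (\<And>\<alpha>. \<alpha> \<in> K \<Longrightarrow> \<bar>\<alpha> a\<bar> < \<delta>) \<Longrightarrow> \<bar>L a\<bar> < e"
    using L_small by blast
  define n where "n = 2 * d"
  have n: "n > 0" using d by (simp add: n_def)
  define g where "g \<alpha> = root n (\<alpha> a)" for \<alpha> :: "'a \<Rightarrow> real"
  have g: "continuous_on K g"
    unfolding g_def by (intro continuous_intros continuous_on_eval)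
  have "bounded (g ` K)"
    using compact_K g compact_continuous_image compact_imp_bounded by blast
  then obtain B where B: "\<And>\<alpha>. \<alpha> \<in> K \<Longrightarrow> \<bar>g \<alpha>\<bar> \<le> B"
    unfolding bounded_iff by auto
  \<comment> \<open>The margin \<open>1\<close> around the range of \<open>g\<close> accommodates
    \<open>\<alpha> b\<close>, which is chosen within \<open>min \<eta> 1\<close> of
    \<open>g \<alpha>\<close>.\<close>
  have "uniformly_continuous_on {-B-1..B+1} (\<lambda>t::real. t ^ n)"
    by (intro compact_uniformly_continuous continuous_intros) auto
  then obtain \<eta> where \<eta>: "\<eta> > 0" "\<And>s t. s \<in> {-B-1..B+1} \<Longrightarrow> t \<in> {-B-1..B+1} \<Longrightarrow> \<bar>t - s\<bar> < \<eta> \<Longrightarrow> \<bar>t ^ n - s ^ n\<bar> < \<delta>"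
    using \<delta>(1) unfolding uniformly_continuous_on_def dist_real_def by meson
  have "min \<eta> 1 > 0" using \<eta>(1) by simp
  then obtain b where b: "\<And>\<alpha>. \<alpha> \<in> K \<Longrightarrow> \<bar>g \<alpha> - \<alpha> b\<bar> < min \<eta> 1"
    using hom_dense[OF g] by blast
  have "\<bar>\<alpha> (a - b ^ n)\<bar> < \<delta>" if \<alpha>: "\<alpha> \<in> K" for \<alpha>
  proof -
    have "\<bar>g \<alpha> ^ n - \<alpha> b ^ n\<bar> < \<delta>"
      using B[OF \<alpha>] b[OF \<alpha>] by (intro \<eta>(2)) auto
    moreover have "g \<alpha> ^ n = \<alpha> a"
      unfolding g_def using n a[OF \<alpha>] by (rule real_root_pow_pos2)
    ultimately show ?thesis
      by (simp add: hom_diff hom_power \<alpha>)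
  qed
  then have "\<bar>L (a - b ^ n)\<bar> < e"
    by (rule \<delta>(2))
  moreover have "0 \<le> L (b ^ n)"
    unfolding n_def by (rule L_power)
  ultimately show "0 \<le> L a + e"
    by (simp add: L_diff)
qed

lemma L_mono:
  assumes "\<And>\<alpha>. \<alpha> \<in> K \<Longrightarrow> \<alpha> a \<le> \<alpha> b"
  shows "L a \<le> L b"
  using L_nonneg[of "b - a"] assms by (simp add: hom_diff L_diff)

text \<open>If \<open>c\<close> approximates \<open>f\<close> within \<open>1 / 2^k\<close>, then
  \<open>c - h ^ k\<close> and \<open>c + h ^ k\<close> bracket \<open>f\<close> on
  \<open>K\<close>, and their values under \<open>L\<close> differ by
  \<open>2 * L 1 / 2^k\<close>.\<close>

lemma squeeze:
  assumes "continuous_on K f" "e > 0"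
  obtains a b where "\<And>\<alpha>. \<alpha> \<in> K \<Longrightarrow> \<alpha> a \<le> f \<alpha>" "\<And>\<alpha>. \<alpha> \<in> K \<Longrightarrow> f \<alpha> \<le> \<alpha> b" "L b \<le> L a + e"
proof -
  have L1: "0 \<le> L 1"
    by (rule L_nonneg) (simp add: hom_1)
  \<comment> \<open>The summand \<open>1\<close> keeps the denominator positive when
    \<open>L 1 = 0\<close>.\<close>
  have "e / (2 * L 1 + 1) > 0"
    using assms(2) L1 by simp
  then obtain k where k: "(1/2) ^ k < e / (2 * L 1 + 1)"
    by (rule power_half_less)
  then have k': "(1/2) ^ k * (2 * L 1 + 1) < e"
    using L1 by (simp add: field_simps)
  have "(0::real) < (1/2) ^ k" by simp
  then obtain c where c: "\<And>\<alpha>. \<alpha> \<in> K \<Longrightarrow> \<bar>f \<alpha> - \<alpha> c\<bar> < (1/2) ^ k"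
    using hom_dense[OF assms(1)] by blast
  have hk: "\<alpha> (h ^ k) = (1/2) ^ k" if "\<alpha> \<in> K" for \<alpha>
    using that by (simp add: hom_power hom_h)
  show ?thesis
  proof
    show "\<alpha> (c - h ^ k) \<le> f \<alpha>" "f \<alpha> \<le> \<alpha> (c + h ^ k)" if "\<alpha> \<in> K" for \<alpha>
      using c[OF that] that by (auto simp: hom_diff hom_add hk)
    have "(0::real) \<le> (1/2) ^ k" by simp
    then show "L (c + h ^ k) \<le> L (c - h ^ k) + e"
      using k' unfolding L_add L_diff L_h_power by (simp only: distrib_left)
  qed
qed

section \<open>The extended functional and the representing measure\<close>

text \<open>The upper extension of \<open>L\<close>; by \<open>squeeze\<close> the ring elements
  below \<open>f\<close> approach the same value.\<close>

definition extension :: "(('a \<Rightarrow> real) \<Rightarrow> real) \<Rightarrow> real" where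
  "extension f = Inf {L a | a. \<forall>\<alpha>\<in>K. f \<alpha> \<le> \<alpha> a}"

lemma extension_ge:
  assumes "continuous_on K f" "\<And>\<alpha>. \<alpha> \<in> K \<Longrightarrow> \<alpha> a \<le> f \<alpha>"
  shows "L a \<le> extension f"
  unfolding extension_def
proof (rule cInf_greatest)
  \<comment> \<open>The infimum is conditional, so some ring element dominating \<open>f\<close> has
    to be exhibited.\<close>
  obtain c b where "\<And>\<alpha>. \<alpha> \<in> K \<Longrightarrow> \<alpha> c \<le> f \<alpha>" "\<And>\<alpha>. \<alpha> \<in> K \<Longrightarrow> f \<alpha> \<le> \<alpha> b" "L b \<le> L c + 1"
    using assms(1) zero_less_one by (rule squeeze) blast
  then show "{L a | a. \<forall>\<alpha>\<in>K. f \<alpha> \<le> \<alpha> a} \<noteq> {}"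
    by blast
  fix t assume "t \<in> {L a | a. \<forall>\<alpha>\<in>K. f \<alpha> \<le> \<alpha> a}"
  then obtain b where t: "t = L b" and b: "\<And>\<alpha>. \<alpha> \<in> K \<Longrightarrow> f \<alpha> \<le> \<alpha> b"
    by blast
  show "L a \<le> t"
    unfolding t by (rule L_mono) (rule order_trans[OF assms(2) b])
qed

lemma extension_le:
  assumes "continuous_on K f" "\<And>\<alpha>. \<alpha> \<in> K \<Longrightarrow> f \<alpha> \<le> \<alpha> b"
  shows "extension f \<le> L b"
  unfolding extension_def
proof (rule cInf_lower)
  \<comment> \<open>The lower element of the bracket shows that the set is bounded below.\<close>
  obtain a b where a: "\<And>\<alpha>. \<alpha> \<in> K \<Longrightarrow> \<alpha> a \<le> f \<alpha>" "\<And>\<alpha>. \<alpha> \<in> K \<Longrightarrow> f \<alpha> \<le> \<alpha> b" "L b \<le> L a + 1"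
    using assms(1) zero_less_one by (rule squeeze) blast
  show "bdd_below {L a | a. \<forall>\<alpha>\<in>K. f \<alpha> \<le> \<alpha> a}"
    using a(1) by (intro bdd_belowI[of _ "L a"]) (auto intro!: L_mono intro: order_trans)
qed (use assms(2) in auto)

lemma extension_eval: "extension (\<lambda>\<alpha>. \<alpha> a) = L a"
  by (intro antisym extension_le extension_ge continuous_on_eval) auto

text \<open>Both sides lie between \<open>L (a + a')\<close> and \<open>L (b + b')\<close>, which
  are at most \<open>e\<close> apart.\<close>

lemma extension_add:
  assumes "continuous_on K f" "continuous_on K g"
  shows "extension (\<lambda>x. f x + g x) = extension f + extension g"
proof -
  have fg: "continuous_on K (\<lambda>x. f x + g x)"
    by (intro continuous_intros assms)
  have "\<bar>extension (\<lambda>x. f x + g x) - (extension f + extension g)\<bar> \<le> e" if "e > 0" for e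
  proof -
    have e: "e / 2 > 0" using that by simp
    obtain a b where f: "\<And>\<alpha>. \<alpha> \<in> K \<Longrightarrow> \<alpha> a \<le> f \<alpha>" "\<And>\<alpha>. \<alpha> \<in> K \<Longrightarrow> f \<alpha> \<le> \<alpha> b" "L b \<le> L a + e / 2"
      using squeeze[OF assms(1) e] by blast
    obtain a' b' where g: "\<And>\<alpha>. \<alpha> \<in> K \<Longrightarrow> \<alpha> a' \<le> g \<alpha>" "\<And>\<alpha>. \<alpha> \<in> K \<Longrightarrow> g \<alpha> \<le> \<alpha> b'" "L b' \<le> L a' + e / 2"
      using squeeze[OF assms(2) e] by blast
    have "L (a + a') \<le> extension (\<lambda>x. f x + g x)"
      using fg by (rule extension_ge) (simp add: hom_add add_mono f g)
    moreover have "extension (\<lambda>x. f x + g x) \<le> L (b + b')"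
      using fg by (rule extension_le) (simp add: hom_add add_mono f g)
    moreover have "L a \<le> extension f" "extension f \<le> L b" "L a' \<le> extension g" "extension g \<le> L b'"
      by (intro extension_ge extension_le assms f g; assumption)+
    ultimately show ?thesis
      using f(3) g(3) by (simp add: L_add)
  qed
  then have "\<bar>extension (\<lambda>x. f x + g x) - (extension f + extension g)\<bar> \<le> 0"
    by (rule dense_ge)
  then show ?thesis by simp
qed

lemma positive_functional_extension: "positive_functional K extension"
proof
  show "0 \<le> extension f" if "continuous_on K f" "\<And>x. x \<in> K \<Longrightarrow> 0 \<le> f x" for f
    using extension_ge[of f 0] that by (simp add: hom_0 L_0)
qed (rule compact_K extension_add; assumption)+

text \<open>The Riesz measure of \<open>extension\<close> represents \<open>L\<close>, since
  \<open>extension\<close> agrees with \<open>L\<close> on evaluations and \<open>hat a\<close> is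
  evaluation at \<open>a\<close> on \<open>K\<close>.\<close>

lemma representing_measure:
  "\<exists>\<mu>. sets \<mu> = sets (restrict_space borel K) \<and>
     (\<forall>a. integrable \<mu> (hat a) \<and> L a = (\<integral>\<alpha>. hat a \<alpha> \<partial>\<mu>))"
proof -
  interpret positive_functional K extension
    by (rule positive_functional_extension)
  have hat: "hat a \<alpha> = \<alpha> a" if "\<alpha> \<in> space riesz" for a \<alpha>
    using that by (simp add: space_riesz hat_eq)
  have "integrable riesz (hat a) \<and> L a = (\<integral>\<alpha>. hat a \<alpha> \<partial>riesz)" for a
  proof
    show "integrable riesz (hat a)"
      using integrable_riesz[OF continuous_on_eval[of a]]
      by (subst Bochner_Integration.integrable_cong[OF refl hat])
    show "L a = (\<integral>\<alpha>. hat a \<alpha> \<partial>riesz)"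
      using eq_integral[OF continuous_on_eval[of a]]
      by (subst Bochner_Integration.integral_cong[OF refl hat]) (simp_all add: extension_eval)
  qed
  then show ?thesis
    using sets_riesz by blast
qed

end

end

theorem corollary4p3:
  fixes h :: "'a::comm_ring_1" and K :: "('a \<Rightarrow> real) set" and d :: nat and L :: "'a \<Rightarrow> real"
  assumes "2 * h = 1"
    and "(real_homs :: ('a \<Rightarrow> real) set) \<noteq> {}"
    and "inj (hat :: 'a \<Rightarrow> ('a \<Rightarrow> real) \<Rightarrow> real)"
    and "K \<subseteq> real_homs" and "compact K"
    and "d \<ge> 1"
    and "continuous_map (seminorm_topology K) euclideanreal L"
    and "dyadic_linear h L"
    and "\<And>a. L (a ^ (2 * d)) \<ge> 0"
  shows "\<exists>\<mu>. sets \<mu> = sets (restrict_space borel K) \<and>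
             (\<forall>a. integrable \<mu> (hat a) \<and> L a = (\<integral>\<alpha>. hat a \<alpha> \<partial>\<mu>))"
  by (rule representing_measure[OF assms(1,4-9)])

end
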